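(* Let $F$ be an Archimedean vector lattice, let $\eta,\theta$ be locally solid additive convergences on $F$ and let $E,H\subset F$ be ideals. Then: (i) If $\theta$ is linear and $\mathrm{u}_{E}\theta\ge \mathrm{u}_{H}\eta$, then $H\subset \overline{E}^{1}_{\eta}$ and $\theta|_{[0,e]}\ge \eta|_{[0,e]}$ for every $0\le e\in E\cap H$. (ii) If $\eta$ is idempotent, then $\mathrm{u}_{E}\theta\ge \mathrm{u}_{H}\eta$ whenever $H\subset \overline{E}^{1}_{\eta}=\overline{E}_{\eta}$ and $\theta|_{[0,e]}\ge \eta|_{[0,e]}$ for every $0\le e\in E\cap H$.
   Context: Nets are indexed by directed sets. A net $(y_\beta)_{\beta\in B}$ is a quasi-subnet of $(x_\alpha)_{\alpha\in A}$ if for every $\alpha_0\in A$ there is $\beta_0\in B$ with $\{y_\beta:\beta\ge\beta_0\}\subset\{x_\alpha:\alpha\ge\alpha_0\}$. A convergence on a set $X$ is a rule specifying which nets in $X$ converge to which points, such that: constant nets converge to their value; a quasi-subnet of a net converging to $x$ converges to $x$; if $(x_\alpha)_{\alpha\in A}$ and $(y_\alpha)_{\alpha\in A}$ converge to $x$ and $z_\alpha\in\{x_\alpha,y_\alpha\}$ for every $\alpha$, then $(z_\alpha)_{\alpha\in A}$ converges to $x$. Let $F$ be a (real) vector lattice with positive cone $F_+$. A convergence on $F$ is additive if addition and $f\mapsto -f$ are continuous (preserve convergence of nets), and linear if addition and scalar multiplication $\mathbb{R}\times F\to F$ are continuous. An additive convergence is locally solid if $f_\alpha\to 0$ and $|g_\alpha|\le|f_\alpha|$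 for all $\alpha$ imply $g_\alpha\to 0$. Such a convergence is determined by its null nets in $F_+$: $f_\alpha\to f$ iff $|f_\alpha-f|\to 0$. $\eta\ge\theta$ means that $\eta$-convergence implies $\theta$-convergence to the same limit; $\theta|_{[0,e]}\ge\eta|_{[0,e]}$ means this (for $\theta$ versus $\eta$) for nets and limits in the order interval $[0,e]$. Composition: $\eta\theta$ is the locally solid additive convergence such that a net $(f_\alpha)\subset F_+$ is $\eta\theta$-null iff there is a $\theta$-null net $(g_\beta)\subset F_+$ with $(f_\alpha-g_\beta)^+\xrightarrow[\alpha]{\eta}0$ for every $\beta$. $\eta$ is idempotent if $\eta\eta=\eta$. Unbounded modification: for an ideal $E\subset F$, $\mathrm{u}_E\eta$ is the locally solid additive convergence such that a net $(f_\alpha)\subset F_+$ is $\mathrm{u}_E\eta$-null iff $|e|\wedge f_\alpha\xrightarrow{\eta}0$ for every $e\in E$. The adherence $\overline{A}^{1}_{\eta}$ is the set of all $\eta$-limits of nets contained in $A$; $A$ is $\eta$-closed if $\overline{A}^{1}_{\eta}=A$; the closure $\overline{A}_{\eta}$ is the smallest $\eta$-closed set containing $A$. (For idempotent $\eta$ the adherence of an ideal equals its closure.) *)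

theory Defs
  imports Complex_Main "HOL-Library.Lattice_Algebras"
begin

section \<open>Vector lattices\<close>

class vector_lattice = ordered_real_vector + lattice_ab_group_add_abs

class archimedean_vector_lattice = vector_lattice +
  assumes archimedean: "0 \<le> x \<Longrightarrow> (\<And>n::nat. real n *\<^sub>R x \<le> y) \<Longrightarrow> x = 0"

definition order_ideal :: "'a::vector_lattice set \<Rightarrow> bool" where
  "order_ideal E \<longleftrightarrow> subspace E \<and> (\<forall>f\<in>E. \<forall>g. \<bar>g\<bar> \<le> \<bar>f\<bar> \<longrightarrow> g \<in> E)"


section \<open>Nets and convergences\<close>

text \<open>
  A directed set is given by its relation alone: \<open>(a, b) \<in> r\<close> reads \<open>a \<le> b\<close>, the
  underlying set is \<open>Field r\<close> (reflexivity makes it recoverable), and the up-set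
  \<open>{b. b \<ge> a}\<close> is \<open>r `` {a}\<close>. A net is a pair of a directed \<open>r\<close> and a function, of which
  only the values on \<open>Field r\<close> matter.
\<close>

definition directed_set :: "'i rel \<Rightarrow> bool" where
  "directed_set r \<longleftrightarrow> Field r \<noteq> {} \<and> Preorder r \<and>
     (\<forall>a\<in>Field r. \<forall>b\<in>Field r. \<exists>c\<in>Field r. (a, c) \<in> r \<and> (b, c) \<in> r)"

definition quasi_subnet :: "'j rel \<Rightarrow> ('j \<Rightarrow> 'a) \<Rightarrow> 'i rel \<Rightarrow> ('i \<Rightarrow> 'a) \<Rightarrow> bool" where
  "quasi_subnet s y r x \<longleftrightarrow>
     (\<forall>a\<in>Field r. \<exists>b\<in>Field s. y ` (s `` {b}) \<subseteq> x ` (r `` {a}))"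

text \<open>
  HOL cannot quantify over directed sets of all types inside a single object, so the
  index sets are subsets of one type \<open>'i\<close>. Nothing is lost as soon as \<open>'i\<close> contains a
  copy of \<open>'a set \<times> 'a\<close>: every net in \<open>'a\<close>, over any index type, is then mutually
  quasi-subnet with a net indexed in \<open>'i\<close> (\<open>net_reindex\<close>), and a convergence does not
  distinguish such nets.
\<close>

lemma net_reindex:
  fixes emb :: "'a set \<times> 'a \<Rightarrow> 'i" and r :: "'j rel" and x :: "'j \<Rightarrow> 'a"
  assumes "inj emb" and r: "directed_set r"
  shows "\<exists>(s :: 'i rel) y. directed_set s \<and> quasi_subnet s y r x \<and> quasi_subnet r x s y"
proof -
  define T where "T a = x ` (r `` {a})" for a
  define I where "I = {(T a, p) | a p. a \<in> Field r \<and> p \<in> T a}"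
  define s where "s = {(emb u, emb v) | u v. u \<in> I \<and> v \<in> I \<and> fst v \<subseteq> fst u}"
  define y where "y = snd \<circ> inv emb"
  have y: "y (emb u) = snd u" for u
    using \<open>inj emb\<close> by (simp add: y_def)
  have emb: "emb u = emb v \<longleftrightarrow> u = v" for u v
    using \<open>inj emb\<close> by (simp add: inj_eq)
  have s: "(emb u, emb v) \<in> s \<longleftrightarrow> u \<in> I \<and> v \<in> I \<and> fst v \<subseteq> fst u" for u v
    by (cases u; cases v) (simp add: s_def emb)
  have F: "Field s = emb ` I"
  proof
    show "Field s \<subseteq> emb ` I"
      unfolding s_def Field_def by blast
    have "(emb u, emb u) \<in> s" if "u \<in> I" for u
      using that s by blast
    then show "emb ` I \<subseteq> Field s"
      unfolding Field_def by blast
  qed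
  have rr: "(a, a) \<in> r" if "a \<in> Field r" for a
    using r that by (auto simp: directed_set_def preorder_on_def refl_on_def)
  have tr: "trans r"
    using r by (auto simp: directed_set_def preorder_on_def)
  have Tm: "T b \<subseteq> T a" if "(a, b) \<in> r" for a b
    using tr that by (auto simp: T_def dest: transD)
  have inI: "(T a, x b) \<in> I" if "(a, b) \<in> r" for a b
    using that by (auto simp: I_def T_def Field_def)
  have sE: "\<exists>v. w = emb v \<and> v \<in> I" if "(z, w) \<in> s" for z w
    using that unfolding s_def by blast
  have tail: "y ` (s `` {emb (T a, p)}) = T a" if u: "(T a, p) \<in> I" for a p
  proof
    show "y ` (s `` {emb (T a, p)}) \<subseteq> T a"
    proof
      fix q assume "q \<in> y ` (s `` {emb (T a, p)})"
      then obtain w where w: "(emb (T a, p), w) \<in> s" "q = y w"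
        by blast
      then obtain v where v: "w = emb v" "v \<in> I"
        using sE by blast
      then have "fst v \<subseteq> T a" "snd v \<in> fst v"
        using w s by (auto simp: I_def)
      then show "q \<in> T a"
        using w v y by auto
    qed
    show "T a \<subseteq> y ` (s `` {emb (T a, p)})"
    proof
      fix q assume "q \<in> T a"
      then have "(T a, q) \<in> I"
        using u unfolding T_def by (auto intro: inI[unfolded T_def])
      then have "(emb (T a, p), emb (T a, q)) \<in> s"
        using u s by simp
      then show "q \<in> y ` (s `` {emb (T a, p)})"
        using y[of "(T a, q)"] by force
    qed
  qed
  have dir: "directed_set s"
  proof -
    obtain a where "a \<in> Field r"
      using r by (auto simp: directed_set_def)
    then have "Field s \<noteq> {}"
      using inI[OF rr] F by auto
    moreover have "Preorder s"
    proof -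
      have "refl_on (Field s) s"
        unfolding F refl_on_def using s by blast
      moreover have "trans s"
      proof (rule transI)
        fix u v w assume uvw: "(u, v) \<in> s" "(v, w) \<in> s"
        then obtain u' v' w' where "u = emb u'" "v = emb v'" "w = emb w'"
          unfolding s_def by blast
        then show "(u, w) \<in> s"
          using uvw s by auto
      qed
      moreover have "s \<subseteq> Field s \<times> Field s"
        by (auto intro: FieldI1 FieldI2)
      ultimately show ?thesis
        by (simp add: preorder_on_def)
    qed
    moreover have "\<exists>c\<in>Field s. (u, c) \<in> s \<and> (v, c) \<in> s"
      if uv: "u \<in> Field s" "v \<in> Field s" for u v
    proof -
      obtain a p b q where a: "u = emb (T a, p)" "(T a, p) \<in> I" "a \<in> Field r"
        and b: "v = emb (T b, q)" "(T b, q) \<in> I" "b \<in> Field r"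
        using uv unfolding F I_def by blast
      obtain c where c: "(a, c) \<in> r" "(b, c) \<in> r" "c \<in> Field r"
        using r a b by (auto simp: directed_set_def)
      have "(T c, x c) \<in> I"
        using inI[OF rr[OF c(3)]] .
      moreover have "T c \<subseteq> T a" "T c \<subseteq> T b"
        using Tm c by auto
      ultimately have "(u, emb (T c, x c)) \<in> s" "(v, emb (T c, x c)) \<in> s"
        using a b s by simp_all
      then show ?thesis
        by (auto simp: Field_def)
    qed
    ultimately show ?thesis
      by (auto simp: directed_set_def)
  qed
  have "quasi_subnet s y r x"
    unfolding quasi_subnet_def
  proof
    fix a assume "a \<in> Field r"
    then have "(T a, x a) \<in> I"
      using inI rr by blast
    then show "\<exists>b\<in>Field s. y ` (s `` {b}) \<subseteq> x ` (r `` {a})"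
      using tail F unfolding T_def by blast
  qed
  moreover have "quasi_subnet r x s y"
    unfolding quasi_subnet_def
  proof
    fix u assume "u \<in> Field s"
    then obtain a p where "u = emb (T a, p)" "(T a, p) \<in> I" "a \<in> Field r"
      unfolding F I_def by blast
    then show "\<exists>b\<in>Field r. x ` (r `` {b}) \<subseteq> y ` (s `` {u})"
      using tail unfolding T_def by blast
  qed
  ultimately show ?thesis
    using dir by blast
qed

text \<open>\<open>\<eta> r f l\<close> reads: the net \<open>f\<close> over \<open>r\<close> converges to \<open>l\<close>.\<close>

type_synonym ('i, 'a) convergence = "'i rel \<Rightarrow> ('i \<Rightarrow> 'a) \<Rightarrow> 'a \<Rightarrow> bool"

text \<open>
  The first clause says that a convergence only speaks about nets, so that equality of
  convergences is equality of functions.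
\<close>

definition is_convergence :: "('i, 'a) convergence \<Rightarrow> bool" where
  "is_convergence \<eta> \<longleftrightarrow>
     (\<forall>r f l. \<eta> r f l \<longrightarrow> directed_set r) \<and>
     (\<forall>r l. directed_set r \<longrightarrow> \<eta> r (\<lambda>_. l) l) \<and>
     (\<forall>r f s g l. \<eta> r f l \<longrightarrow> directed_set s \<longrightarrow> quasi_subnet s g r f \<longrightarrow> \<eta> s g l) \<and>
     (\<forall>r f g h l. \<eta> r f l \<longrightarrow> \<eta> r g l \<longrightarrow> (\<forall>a\<in>Field r. h a \<in> {f a, g a}) \<longrightarrow> \<eta> r h l)"

definition stronger_on :: "'a set \<Rightarrow> ('i, 'a) convergence \<Rightarrow> ('i, 'a) convergence \<Rightarrow> bool" where
  "stronger_on S \<eta> \<theta> \<longleftrightarrow>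
     (\<forall>r f l. f ` Field r \<subseteq> S \<longrightarrow> l \<in> S \<longrightarrow> \<eta> r f l \<longrightarrow> \<theta> r f l)"

text \<open>\<open>stronger \<eta> \<theta>\<close> is \<open>\<eta> \<ge> \<theta>\<close>.\<close>

abbreviation stronger :: "('i, 'a) convergence \<Rightarrow> ('i, 'a) convergence \<Rightarrow> bool" where
  "stronger \<equiv> stronger_on UNIV"

definition adherence :: "('i, 'a) convergence \<Rightarrow> 'a set \<Rightarrow> 'a set" where
  "adherence \<eta> A = {l. \<exists>r f. f ` Field r \<subseteq> A \<and> \<eta> r f l}"

definition conv_closed :: "('i, 'a) convergence \<Rightarrow> 'a set \<Rightarrow> bool" where
  "conv_closed \<eta> A \<longleftrightarrow> adherence \<eta> A = A"

definition conv_closure :: "('i, 'a) convergence \<Rightarrow> 'a set \<Rightarrow> 'a set" where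
  "conv_closure \<eta> A = \<Inter> {B. A \<subseteq> B \<and> conv_closed \<eta> B}"

lemma subset_adherence:
  fixes \<eta> :: "('i, 'a) convergence"
  assumes "is_convergence \<eta>"
  shows "A \<subseteq> adherence \<eta> A"
proof
  fix l assume "l \<in> A"
  define r where "r = {(undefined :: 'i, undefined :: 'i)}"
  have "directed_set r"
    by (auto simp: r_def directed_set_def preorder_on_def refl_on_def trans_def Field_def)
  then have "\<eta> r (\<lambda>_. l) l"
    using assms by (simp add: is_convergence_def)
  moreover have "(\<lambda>_. l) ` Field r \<subseteq> A"
    using \<open>l \<in> A\<close> by blast
  ultimately show "l \<in> adherence \<eta> A"
    unfolding adherence_def by blast
qed

lemma conv_closed_closure:
  assumes "is_convergence \<eta>"
  shows "conv_closed \<eta> (conv_closure \<eta> A)"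
proof -
  have "adherence \<eta> (conv_closure \<eta> A) \<subseteq> B" if "A \<subseteq> B" "conv_closed \<eta> B" for B
  proof -
    have "conv_closure \<eta> A \<subseteq> B"
      using that by (auto simp: conv_closure_def)
    then have "adherence \<eta> (conv_closure \<eta> A) \<subseteq> adherence \<eta> B"
      unfolding adherence_def by blast
    then show ?thesis
      using that by (simp add: conv_closed_def)
  qed
  then have "adherence \<eta> (conv_closure \<eta> A) \<subseteq> conv_closure \<eta> A"
    unfolding conv_closure_def by blast
  then show ?thesis
    using subset_adherence[OF assms] by (auto simp: conv_closed_def)
qed


section \<open>Locally solid additive convergences\<close>

definition additive_convergence :: "('i, 'a::vector_lattice) convergence \<Rightarrow> bool" where
  "additive_convergence \<eta> \<longleftrightarrow> is_convergence \<eta> \<and>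
     (\<forall>r f g l m. \<eta> r f l \<longrightarrow> \<eta> r g m \<longrightarrow> \<eta> r (\<lambda>a. f a + g a) (l + m)) \<and>
     (\<forall>r f l. \<eta> r f l \<longrightarrow> \<eta> r (\<lambda>a. - f a) (- l))"

definition section_filter :: "'i rel \<Rightarrow> 'i filter" where
  "section_filter r = (INF a\<in>Field r. principal (r `` {a}))"

definition linear_convergence :: "('i, 'a::vector_lattice) convergence \<Rightarrow> bool" where
  "linear_convergence \<eta> \<longleftrightarrow> is_convergence \<eta> \<and>
     (\<forall>r f g l m. \<eta> r f l \<longrightarrow> \<eta> r g m \<longrightarrow> \<eta> r (\<lambda>a. f a + g a) (l + m)) \<and>
     (\<forall>r t f c l. (t \<longlongrightarrow> (c::real)) (section_filter r) \<longrightarrow> \<eta> r f l \<longrightarrow>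
        \<eta> r (\<lambda>a. t a *\<^sub>R f a) (c *\<^sub>R l))"

definition locally_solid_additive :: "('i, 'a::vector_lattice) convergence \<Rightarrow> bool" where
  "locally_solid_additive \<eta> \<longleftrightarrow> additive_convergence \<eta> \<and>
     (\<forall>r f g. \<eta> r f 0 \<longrightarrow> (\<forall>a\<in>Field r. \<bar>g a\<bar> \<le> \<bar>f a\<bar>) \<longrightarrow> \<eta> r g 0)"

text \<open>The locally solid additive convergence with prescribed null nets \<open>N\<close> in the positive cone.\<close>

definition from_null :: "('i rel \<Rightarrow> ('i \<Rightarrow> 'a) \<Rightarrow> bool) \<Rightarrow> ('i, 'a::vector_lattice) convergence" where
  "from_null N r f l \<longleftrightarrow> N r (\<lambda>a. \<bar>f a - l\<bar>)"

definition conv_comp ::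
  "('i, 'a::vector_lattice) convergence \<Rightarrow> ('i, 'a) convergence \<Rightarrow> ('i, 'a) convergence" where
  "conv_comp \<eta> \<theta> = from_null (\<lambda>r f. \<exists>s g. (\<forall>b\<in>Field s. 0 \<le> g b) \<and> \<theta> s g 0 \<and>
     (\<forall>b\<in>Field s. \<eta> r (\<lambda>a. pprt (f a - g b)) 0))"

definition idempotent_convergence :: "('i, 'a::vector_lattice) convergence \<Rightarrow> bool" where
  "idempotent_convergence \<eta> \<longleftrightarrow> conv_comp \<eta> \<eta> = \<eta>"

definition unbounded_mod ::
  "'a::vector_lattice set \<Rightarrow> ('i, 'a) convergence \<Rightarrow> ('i, 'a) convergence" where
  "unbounded_mod E \<eta> = from_null (\<lambda>r f. \<forall>e\<in>E. \<eta> r (\<lambda>a. inf \<bar>e\<bar> (f a)) 0)"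

end

theory Submission
  imports Defs
begin

text \<open>
  Let \<open>E\<^sub>+\<close> be directed upwards by the order. A point \<open>l\<close> lies in the adherence of the ideal \<open>E\<close>
  iff the net \<open>(\<bar>l\<bar> - e)\<^sup>+\<close>, \<open>e \<in> E\<^sub>+\<close>, is \<open>\<eta>\<close>-null. For idempotent \<open>\<eta>\<close> this makes the
  adherence closed, since \<open>((\<bar>l\<bar> - e)\<^sup>+ - \<bar>y - l\<bar>)\<^sup>+ \<le> (\<bar>y\<bar> - e)\<^sup>+\<close>. For (i), one has
  \<open>e \<and> (\<bar>h\<bar> - e')\<^sup>+ \<le> \<bar>h\<bar> / n\<close> as soon as \<open>e' \<ge> n e \<ge> 0\<close>, so for linear \<open>\<theta>\<close> the net
  \<open>(\<bar>h\<bar> - e')\<^sup>+\<close> is \<open>u\<^sub>E\<theta>\<close>-null, hence \<open>u\<^sub>H\<eta>\<close>-null, and for \<open>h \<in> H\<close> it is bounded by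
  \<open>\<bar>h\<bar> \<in> H\<close>. For (ii), if \<open>x\<^sub>b \<in> E\<close> converges to \<open>h \<in> H\<close>, then
  \<open>(\<bar>h\<bar> \<and> \<phi> - \<bar>x\<^sub>b - h\<bar>)\<^sup>+ \<le> (\<bar>h\<bar> \<and> \<bar>x\<^sub>b\<bar>) \<and> \<phi>\<close> for \<open>\<phi> \<ge> 0\<close>, with
  \<open>\<bar>h\<bar> \<and> \<bar>x\<^sub>b\<bar> \<in> E \<inter> H\<close>, and idempotency applies.
\<close>

section \<open>Positive parts and infima in lattice-ordered groups\<close>

lemma abs_pprt: "\<bar>pprt x\<bar> = pprt (x::'a::lattice_ab_group_add_abs)"
  by (simp add: abs_of_nonneg)

lemma pprt_le_iff: "pprt x \<le> y \<longleftrightarrow> x \<le> y \<and> 0 \<le> (y::'a::lattice_ab_group_add_abs)"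
  by (simp add: pprt_def)

lemma abs_inf_nonneg:
  fixes x y :: "'a::lattice_ab_group_add_abs"
  assumes "0 \<le> x" "0 \<le> y"
  shows "\<bar>inf x y\<bar> = inf x y"
  using assms by (simp add: abs_of_nonneg)

text \<open>The two parts are \<open>x\<close> and \<open>0\<close> translated by
  \<open>- nprt x\<close>. Translations commute with infima, so what remains is
  \<open>inf x 0 - nprt x\<close>, which vanishes by the definition of \<open>nprt\<close>.\<close>

lemma inf_pprt_pprt_uminus:
  "inf (pprt x) (pprt (- x)) = (0::'a::lattice_ab_group_add_abs)"
proof -
  have "pprt x = x + - nprt x" "pprt (- x) = 0 + - nprt x"
    using prts[of x] by (simp_all add: pprt_neg algebra_simps)
  then have "inf (pprt x) (pprt (- x)) = inf x 0 + - nprt x"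
    by (simp only: add_inf_distrib_right)
  then show ?thesis
    by (simp only: nprt_def add.right_inverse)
qed

text \<open>The error of truncating \<open>x\<close> at \<open>y\<close>: through it, null positive
  parts control the convergence of truncations.\<close>

lemma diff_inf_eq_pprt: "x - inf x y = pprt (x - (y::'a::lattice_ab_group_add_abs))"
proof -
  have "x - inf x y = x + sup (- x) (- y)"
    by (simp add: neg_inf_eq_sup)
  also have "\<dots> = sup (x - x) (x - y)"
    by (simp add: add_sup_distrib_left)
  finally show ?thesis
    by (simp add: pprt_def sup_commute)
qed

lemma pprt_diff_mono:
  "x \<le> x' \<Longrightarrow> pprt (x - y) \<le> pprt (x' - (y::'a::lattice_ab_group_add_abs))"
  by (intro pprt_mono) simp

lemma pprt_abs_diff_le: "pprt (\<bar>x\<bar> - \<bar>y\<bar>) \<le> \<bar>x - (y::'a::lattice_ab_group_add_abs)\<bar>"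
  unfolding pprt_le_iff using abs_triangle_ineq[of "x - y" y] by (simp add: algebra_simps)

text \<open>Put \<open>c = n + 1\<close> and \<open>x = c e - u\<close>. Once \<open>u / c\<close>
  is subtracted, the infimum lies below both \<open>pprt x\<close> and \<open>pprt (- x)\<close>.
  These are disjoint, so the difference is at most \<open>0\<close>.\<close>

lemma scaleR_inf_pprt_le:
  fixes u e e' :: "'a::vector_lattice"
  assumes "0 \<le> u" "0 \<le> e" "real (Suc n) *\<^sub>R e \<le> e'"
  shows "inf e (pprt (u - e')) \<le> inverse (real (Suc n)) *\<^sub>R u"
proof -
  define c where "c = real (Suc n)"
  have c: "0 < c" "1 \<le> c" "c *\<^sub>R e \<le> e'"
    using assms by (auto simp: c_def)
  define z where "z = inf e (pprt (u - e'))"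
  define x where "x = c *\<^sub>R e - u"
  have zle: "z \<le> e" "z \<le> pprt (u - e')"
    by (auto simp: z_def)
  have "pprt (u - e') \<le> pprt (- x)"
    using c by (intro pprt_mono) (simp add: x_def)
  then have 1: "z - inverse c *\<^sub>R u \<le> pprt (- x)"
    using zle scaleR_nonneg_nonneg[of "inverse c" u] c assms(1)
    by (meson diff_left_mono diff_le_eq le_add_same_cancel1 less_imp_le order_trans positive_imp_inverse_positive)
  have "c *\<^sub>R (z - inverse c *\<^sub>R u) = c *\<^sub>R z - u"
    using c by (simp add: scaleR_diff_right)
  also have "\<dots> \<le> x"
    unfolding x_def using zle c by (intro diff_right_mono scaleR_left_mono) auto
  also have "x \<le> pprt x"
    by (simp add: pprt_def)
  finally have "inverse c *\<^sub>R (c *\<^sub>R (z - inverse c *\<^sub>R u)) \<le> inverse c *\<^sub>R pprt x"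
    using c by (intro scaleR_left_mono) auto
  then have "z - inverse c *\<^sub>R u \<le> inverse c *\<^sub>R pprt x"
    using c by simp
  \<comment> \<open>The factor \<open>inverse c\<close> may be dropped: \<open>Suc n\<close> ensures
    \<open>c \<ge> 1\<close>, and \<open>pprt x\<close> is nonnegative.\<close>
  also have "\<dots> \<le> 1 *\<^sub>R pprt x"
    using c by (intro scaleR_right_mono) (auto simp: inverse_le_1_iff)
  finally have "z - inverse c *\<^sub>R u \<le> inf (pprt x) (pprt (- x))"
    using 1 by simp
  then show ?thesis
    by (simp add: inf_pprt_pprt_uminus z_def c_def)
qed

section \<open>Order ideals\<close>

lemma order_ideal_mem: "order_ideal E \<Longrightarrow> f \<in> E \<Longrightarrow> \<bar>g\<bar> \<le> \<bar>f\<bar> \<Longrightarrow> g \<in> E"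
  by (auto simp: order_ideal_def)

lemma order_ideal_abs: "order_ideal E \<Longrightarrow> f \<in> E \<Longrightarrow> \<bar>f\<bar> \<in> E"
  by (rule order_ideal_mem[of E f]) simp_all

lemma order_ideal_inf:
  "order_ideal E \<Longrightarrow> e \<in> E \<Longrightarrow> 0 \<le> e \<Longrightarrow> 0 \<le> x \<Longrightarrow> inf x e \<in> E"
  by (rule order_ideal_mem[of E e]) (simp_all add: abs_inf_nonneg)

section \<open>Directed sets transported into the index type\<close>

text \<open>The relation \<open>P\<close> on \<open>I\<close>, copied along \<open>k\<close>. Nets
  must be indexed in the one type \<open>'i\<close>, so natural numbers, cones and pairs all enter
  as index sets through such injective copies.\<close>

definition rel_image :: "('j \<Rightarrow> 'i) \<Rightarrow> 'j set \<Rightarrow> ('j \<Rightarrow> 'j \<Rightarrow> bool) \<Rightarrow> 'i rel" where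
  "rel_image k I P = {(k u, k v) | u v. u \<in> I \<and> v \<in> I \<and> P u v}"

lemma Image_rel_image:
  "inj k \<Longrightarrow> u \<in> I \<Longrightarrow> rel_image k I P `` {k u} = k ` {v \<in> I. P u v}"
  by (auto simp: rel_image_def inj_eq)

lemma Field_rel_image:
  assumes "\<And>u. u \<in> I \<Longrightarrow> P u u"
  shows "Field (rel_image k I P) = k ` I"
proof
  show "Field (rel_image k I P) \<subseteq> k ` I"
    by (auto simp: rel_image_def Field_def)
  have "(k u, k u) \<in> rel_image k I P" if "u \<in> I" for u
    using that assms by (auto simp: rel_image_def)
  then show "k ` I \<subseteq> Field (rel_image k I P)"
    by (auto intro: FieldI1)
qed

lemma directed_set_rel_image:
  assumes k: "inj k" and "I \<noteq> {}" and refl: "\<And>u. u \<in> I \<Longrightarrow> P u u"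
    and trans: "\<And>u v w. P u v \<Longrightarrow> P v w \<Longrightarrow> P u w"
    and dir: "\<And>u v. u \<in> I \<Longrightarrow> v \<in> I \<Longrightarrow> \<exists>w\<in>I. P u w \<and> P v w"
  shows "directed_set (rel_image k I P)"
proof -
  let ?r = "rel_image k I P"
  have F: "Field ?r = k ` I"
    using refl by (rule Field_rel_image)
  have mem: "(k u, k v) \<in> ?r \<longleftrightarrow> u \<in> I \<and> v \<in> I \<and> P u v" for u v
    using k by (auto simp: rel_image_def inj_eq)
  have "trans_on UNIV ?r"
  proof (rule trans_onI)
    fix x y z assume xyz: "(x, y) \<in> ?r" "(y, z) \<in> ?r"
    then obtain u v w where "x = k u" "y = k v" "z = k w"
      unfolding rel_image_def by blast
    then show "(x, z) \<in> ?r"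
      using xyz mem trans by blast
  qed
  moreover have "refl_on (Field ?r) ?r" "?r \<subseteq> Field ?r \<times> Field ?r"
    using refl F mem by (auto simp: refl_on_def intro: FieldI1 FieldI2)
  moreover have "\<exists>c\<in>Field ?r. (a, c) \<in> ?r \<and> (b, c) \<in> ?r" if ab: "a \<in> Field ?r" "b \<in> Field ?r" for a b
  proof -
    obtain u v where u: "a = k u" "u \<in> I" and v: "b = k v" "v \<in> I"
      using ab F by auto
    then obtain w where "w \<in> I" "P u w" "P v w"
      using dir by blast
    then show ?thesis
      using u v F mem by (intro bexI[of _ "k w"]) simp_all
  qed
  ultimately show ?thesis
    using F \<open>I \<noteq> {}\<close> by (simp add: directed_set_def preorder_on_def)
qed

section \<open>Calculus of locally solid additive convergences\<close>

lemma directed_set_refl: "directed_set r \<Longrightarrow> a \<in> Field r \<Longrightarrow> (a, a) \<in> r"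
  by (auto simp: directed_set_def preorder_on_def refl_on_def)

lemma lsa_is_convergence: "locally_solid_additive \<eta> \<Longrightarrow> is_convergence \<eta>"
  by (simp add: locally_solid_additive_def additive_convergence_def)

lemma lsa_directed: "locally_solid_additive \<eta> \<Longrightarrow> \<eta> r f l \<Longrightarrow> directed_set r"
  using lsa_is_convergence unfolding is_convergence_def by blast

lemma lsa_const: "locally_solid_additive \<eta> \<Longrightarrow> directed_set r \<Longrightarrow> \<eta> r (\<lambda>_. l) l"
  using lsa_is_convergence unfolding is_convergence_def by blast

lemma lsa_quasi_subnet:
  "locally_solid_additive \<eta> \<Longrightarrow> \<eta> r f l \<Longrightarrow> directed_set s \<Longrightarrow> quasi_subnet s g r f \<Longrightarrow> \<eta> s g l"
  using lsa_is_convergence unfolding is_convergence_def by blast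

lemma lsa_dominated:
  "locally_solid_additive \<eta> \<Longrightarrow> \<eta> r f 0 \<Longrightarrow> (\<And>a. a \<in> Field r \<Longrightarrow> \<bar>g a\<bar> \<le> \<bar>f a\<bar>) \<Longrightarrow> \<eta> r g 0"
  unfolding locally_solid_additive_def by blast

lemma lsa_add:
  "locally_solid_additive \<eta> \<Longrightarrow> \<eta> r f l \<Longrightarrow> \<eta> r g m \<Longrightarrow> \<eta> r (\<lambda>a. f a + g a) (l + m)"
  unfolding locally_solid_additive_def additive_convergence_def by blast

lemma lsa_uminus:
  "locally_solid_additive \<eta> \<Longrightarrow> \<eta> r f l \<Longrightarrow> \<eta> r (\<lambda>a. - f a) (- l)"
  unfolding locally_solid_additive_def additive_convergence_def by blast

text \<open>Adding a constant net shifts the limit, and solidity makes a net and its absolute value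
  null together.\<close>

lemma lsa_conv_iff_null:
  assumes \<eta>: "locally_solid_additive \<eta>"
  shows "\<eta> r f l \<longleftrightarrow> \<eta> r (\<lambda>a. \<bar>f a - l\<bar>) 0"
proof
  assume f: "\<eta> r f l"
  have "\<eta> r (\<lambda>a. f a + - l) (l + - l)"
    by (rule lsa_add[OF \<eta>, OF f, OF lsa_const[OF \<eta>], OF lsa_directed[OF \<eta>, OF f]])
  then have "\<eta> r (\<lambda>a. f a - l) 0"
    by simp
  then show "\<eta> r (\<lambda>a. \<bar>f a - l\<bar>) 0"
    by (rule lsa_dominated[OF \<eta>]) simp
next
  assume f: "\<eta> r (\<lambda>a. \<bar>f a - l\<bar>) 0"
  then have "\<eta> r (\<lambda>a. f a - l) 0"
    by (rule lsa_dominated[OF \<eta>]) simp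
  then have "\<eta> r (\<lambda>a. f a - l + l) (0 + l)"
    by (rule lsa_add[OF \<eta>, OF _ lsa_const[OF \<eta>]]) (rule lsa_directed[OF \<eta>, OF f])
  then show "\<eta> r f l"
    by simp
qed

text \<open>
  The index set consists of the pairs \<open>(A, p)\<close> with \<open>A\<close> a tail of \<open>f\<close> and \<open>p\<close> in the solid hull
  of \<open>A\<close>: it fits into \<open>'a set \<times> 'a\<close>, which a product of the given index sets need not.
\<close>

lemma lsa_tail_dominated:
  fixes \<eta> :: "('i, 'a::vector_lattice) convergence" and emb :: "'a set \<times> 'a \<Rightarrow> 'i"
  assumes emb: "inj emb" and \<eta>: "locally_solid_additive \<eta>"
    and f: "\<eta> r f 0" and s: "directed_set s"
    and dom: "\<And>a. a \<in> Field r \<Longrightarrow> \<exists>b\<in>Field s. \<forall>c\<in>s `` {b}. \<exists>a'\<in>r `` {a}. \<bar>y c\<bar> \<le> \<bar>f a'\<bar>"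
  shows "\<eta> s y 0"
proof -
  have r: "directed_set r"
    by (rule lsa_directed[OF \<eta>]) (rule f)
  define T where "T a = f ` (r `` {a})" for a
  define I where "I = {(T a, p) | a p. a \<in> Field r \<and> (\<exists>q\<in>T a. \<bar>p\<bar> \<le> \<bar>q\<bar>)}"
  \<comment> \<open>Only the tails are compared, by reverse inclusion; the second components are
    free. Hence the values of \<open>snd\<close> above \<open>(T a, p)\<close> fill exactly the
    solid hull of \<open>T a\<close>.\<close>
  define t where "t = rel_image emb I (\<lambda>u v. fst v \<subseteq> fst u)"
  have F: "Field t = emb ` I"
    unfolding t_def by (rule Field_rel_image) simp
  have fT: "f a \<in> T a" if "a \<in> Field r" for a
    using directed_set_refl[OF r that] by (auto simp: T_def)
  have tr: "trans r"
    using r by (auto simp: directed_set_def preorder_on_def)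
  have Tm: "T b \<subseteq> T a" if "(a, b) \<in> r" for a b
    using tr that by (auto simp: T_def dest: transD)
  have inI: "(T a, f a) \<in> I" if "a \<in> Field r" for a
    using fT that by (auto simp: I_def)
  have t: "directed_set t"
    unfolding t_def
  proof (rule directed_set_rel_image[OF emb])
    show "I \<noteq> {}"
      using r inI by (auto simp: directed_set_def)
  next
    fix u v assume "u \<in> I" "v \<in> I"
    then obtain a b where ab: "a \<in> Field r" "b \<in> Field r" "fst u = T a" "fst v = T b"
      by (auto simp: I_def)
    obtain c where c: "c \<in> Field r" "(a, c) \<in> r" "(b, c) \<in> r"
      using r ab unfolding directed_set_def by blast
    show "\<exists>w\<in>I. fst w \<subseteq> fst u \<and> fst w \<subseteq> fst v"
      using inI[OF c(1)] Tm[OF c(2)] Tm[OF c(3)] ab by (intro bexI[of _ "(T c, f c)"]) auto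
  qed auto
  \<comment> \<open>A dominating point inside the tail: \<open>w\<close> yields a quasi-subnet of
    \<open>f\<close>, so it is null, and solidity passes this on to \<open>snd\<close>.\<close>
  define w where "w u = (SOME q. q \<in> fst u \<and> \<bar>snd u\<bar> \<le> \<bar>q\<bar>)" for u :: "'a set \<times> 'a"
  have w: "w u \<in> fst u \<and> \<bar>snd u\<bar> \<le> \<bar>w u\<bar>" if "u \<in> I" for u
  proof -
    have "\<exists>q. q \<in> fst u \<and> \<bar>snd u\<bar> \<le> \<bar>q\<bar>"
      using that by (auto simp: I_def)
    then show ?thesis
      unfolding w_def by (rule someI_ex)
  qed
  have "quasi_subnet t (w \<circ> inv emb) r f"
    unfolding quasi_subnet_def
  proof
    fix a assume a: "a \<in> Field r"
    have "(w \<circ> inv emb) ` (t `` {emb (T a, f a)}) \<subseteq> T a"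
      using w emb by (auto simp: t_def Image_rel_image[OF emb inI[OF a]] simp del: o_apply)
        (metis comp_apply inv_f_f subsetD fst_conv)
    then show "\<exists>b\<in>Field t. (w \<circ> inv emb) ` (t `` {b}) \<subseteq> f ` (r `` {a})"
      using F inI[OF a] T_def by blast
  qed
  then have "\<eta> t (w \<circ> inv emb) 0"
    by (rule lsa_quasi_subnet[OF \<eta>, OF f t])
  then have z: "\<eta> t (snd \<circ> inv emb) 0"
    by (rule lsa_dominated[OF \<eta>]) (use F w emb in auto)
  \<comment> \<open>By \<open>dom\<close>, some tail of \<open>y\<close> lies in the solid hull of
    \<open>T a\<close>, which is what a tail of \<open>snd\<close> over \<open>t\<close> looks
    like.\<close>
  have "quasi_subnet s y t (snd \<circ> inv emb)"
    unfolding quasi_subnet_def F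
  proof
    fix i assume "i \<in> emb ` I"
    then obtain a p where a: "a \<in> Field r" "i = emb (T a, p)" "(T a, p) \<in> I"
      by (auto simp: I_def)
    obtain b where b: "b \<in> Field s" "\<And>c. c \<in> s `` {b} \<Longrightarrow> \<exists>a'\<in>r `` {a}. \<bar>y c\<bar> \<le> \<bar>f a'\<bar>"
      using dom[OF a(1)] by blast
    have "y ` (s `` {b}) \<subseteq> (snd \<circ> inv emb) ` (t `` {i})"
    proof
      fix p' assume "p' \<in> y ` (s `` {b})"
      then have "(T a, p') \<in> I"
        using b(2) a(1) unfolding I_def T_def by blast
      moreover have "p' = (snd \<circ> inv emb) (emb (T a, p'))"
        using emb by simp
      ultimately show "p' \<in> (snd \<circ> inv emb) ` (t `` {i})"
        unfolding a(2) t_def Image_rel_image[OF emb a(3)] by (intro image_eqI) auto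
    qed
    then show "\<exists>b\<in>Field s. y ` (s `` {b}) \<subseteq> (snd \<circ> inv emb) ` (t `` {i})"
      using b(1) by blast
  qed
  then show ?thesis
    by (rule lsa_quasi_subnet[OF \<eta>, OF z s])
qed

text \<open>Linearity of \<open>\<theta>\<close> enters here: the scalars tend to \<open>0\<close>
  along the section filter while the constant net \<open>h\<close> converges to \<open>h\<close>.
  The injection \<open>k\<close> supplies a copy of the natural numbers among the indices.\<close>

lemma linear_inverse_Suc_null:
  fixes \<theta> :: "('i, 'a::vector_lattice) convergence" and k :: "nat \<Rightarrow> 'i"
  assumes k: "inj k" and \<theta>: "linear_convergence \<theta>"
  shows "\<theta> (rel_image k UNIV (\<le>)) (\<lambda>i. inverse (real (Suc (inv k i))) *\<^sub>R h) 0"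
proof -
  let ?r = "rel_image k UNIV (\<le>)"
  have F: "Field ?r = range k"
    by (rule Field_rel_image) simp
  have "directed_set ?r"
    by (rule directed_set_rel_image[OF k]) (auto intro: max.cobounded1 max.cobounded2)
  then have "\<theta> ?r (\<lambda>_. h) h"
    using \<theta> by (simp add: linear_convergence_def is_convergence_def)
  moreover have "filterlim (inv k) sequentially (section_filter ?r)"
    unfolding filterlim_at_top section_filter_def
  proof
    fix N
    have "eventually (\<lambda>i. N \<le> inv k i) (principal (?r `` {k N}))"
      using k by (auto simp: eventually_principal Image_rel_image)
    then show "eventually (\<lambda>i. N \<le> inv k i) (INF a\<in>Field ?r. principal (?r `` {a}))"
      using F by (intro eventually_INF1[of "k N"]) auto
  qed
  then have "((\<lambda>i. inverse (real (Suc (inv k i)))) \<longlongrightarrow> 0) (section_filter ?r)"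
    by (rule filterlim_compose[OF LIMSEQ_inverse_real_of_nat])
  ultimately have "\<theta> ?r (\<lambda>i. inverse (real (Suc (inv k i))) *\<^sub>R h) (0 *\<^sub>R h)"
    using \<theta> unfolding linear_convergence_def by blast
  then show ?thesis
    by simp
qed

section \<open>The positive cone of an ideal as an index set\<close>

text \<open>The empty set is a dummy first component, so that \<open>emb\<close> can also embed
  single elements; \<open>cone_elem\<close> reads the element back from its index.\<close>

definition cone_rel :: "('a::vector_lattice set \<times> 'a \<Rightarrow> 'i) \<Rightarrow> 'a set \<Rightarrow> 'i rel" where
  "cone_rel emb E = rel_image (\<lambda>e. emb ({}, e)) {e \<in> E. 0 \<le> e} (\<le>)"

definition cone_elem :: "('a set \<times> 'a \<Rightarrow> 'i) \<Rightarrow> 'i \<Rightarrow> 'a" where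
  "cone_elem emb = inv (\<lambda>e. emb ({}, e))"

lemma inj_emb_Pair: "inj emb \<Longrightarrow> inj (\<lambda>e. emb (A, e))"
  by (simp add: inj_def)

lemma cone_elem_emb: "inj emb \<Longrightarrow> cone_elem emb (emb ({}, e)) = e"
  unfolding cone_elem_def by (rule inv_f_f[OF inj_emb_Pair])

lemma Field_cone_rel: "Field (cone_rel emb E) = (\<lambda>e. emb ({}, e)) ` {e \<in> E. 0 \<le> e}"
  unfolding cone_rel_def by (rule Field_rel_image) simp

lemma cone_elem_Field:
  "inj emb \<Longrightarrow> a \<in> Field (cone_rel emb E) \<Longrightarrow> cone_elem emb a \<in> E \<and> 0 \<le> cone_elem emb a"
  by (auto simp: Field_cone_rel cone_elem_emb)

lemma directed_cone_rel:
  assumes "inj emb" "order_ideal E"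
  shows "directed_set (cone_rel emb E)"
  unfolding cone_rel_def
proof (rule directed_set_rel_image)
  have E: "subspace E"
    using assms by (simp add: order_ideal_def)
  show "{e \<in> E. 0 \<le> e} \<noteq> {}"
    using subspace_0[OF E] by auto
  show "\<exists>w\<in>{e \<in> E. 0 \<le> e}. u \<le> w \<and> v \<le> w" if "u \<in> {e \<in> E. 0 \<le> e}" "v \<in> {e \<in> E. 0 \<le> e}" for u v
    using that subspace_add[OF E] by (intro bexI[of _ "u + v"]) auto
qed (auto intro: inj_emb_Pair assms)

text \<open>The case of \<open>lsa_tail_dominated\<close> in which \<open>f a\<close> itself,
  available by reflexivity of \<open>r\<close>, is the dominating member of the tail at
  \<open>a\<close>. It remains to find a threshold in the cone for each \<open>a\<close>.\<close>

lemma cone_tail_dominated: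
  fixes \<eta> :: "('i, 'a::vector_lattice) convergence" and emb :: "'a set \<times> 'a \<Rightarrow> 'i"
  assumes emb: "inj emb" and \<eta>: "locally_solid_additive \<eta>" and E: "order_ideal E"
    and f: "\<eta> r f 0"
    and dom: "\<And>a. a \<in> Field r \<Longrightarrow> \<exists>e\<in>E. 0 \<le> e \<and> (\<forall>e'\<in>E. e \<le> e' \<longrightarrow> \<bar>y e'\<bar> \<le> \<bar>f a\<bar>)"
  shows "\<eta> (cone_rel emb E) (\<lambda>a. y (cone_elem emb a)) 0"
proof (rule lsa_tail_dominated[OF emb \<eta>, OF f directed_cone_rel[OF emb E]])
  fix a assume a: "a \<in> Field r"
  obtain e where e: "e \<in> E" "0 \<le> e" "\<And>e'. e' \<in> E \<Longrightarrow> e \<le> e' \<Longrightarrow> \<bar>y e'\<bar> \<le> \<bar>f a\<bar>"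
    using dom[OF a] by blast
  have "(a, a) \<in> r"
    by (rule directed_set_refl[OF lsa_directed[OF \<eta>, OF f] a])
  moreover have "\<bar>y (cone_elem emb c)\<bar> \<le> \<bar>f a\<bar>" if "c \<in> cone_rel emb E `` {emb ({}, e)}" for c
    using that e cone_elem_emb[OF emb]
    unfolding cone_rel_def by (subst (asm) Image_rel_image[OF inj_emb_Pair[OF emb]]) auto
  ultimately show "\<exists>b\<in>Field (cone_rel emb E). \<forall>c\<in>cone_rel emb E `` {b}.
      \<exists>a'\<in>r `` {a}. \<bar>y (cone_elem emb c)\<bar> \<le> \<bar>f a'\<bar>"
    using e(1,2) unfolding Field_cone_rel by blast
qed

section \<open>Adherence and closure of an ideal\<close>

text \<open>If \<open>f\<close> in \<open>E\<close> converges to \<open>l\<close>, then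
  \<open>pprt (\<bar>l\<bar> - e')\<close> is at most \<open>\<bar>f a - l\<bar>\<close> as soon as
  \<open>e'\<close> dominates \<open>\<bar>f a\<bar>\<close>. Conversely, truncating the two parts
  of \<open>l\<close> at cone elements gives a net in \<open>E\<close> that converges to
  \<open>l\<close>. One canonical net thus replaces all nets in \<open>E\<close>.\<close>

lemma adherence_ideal_iff:
  fixes \<eta> :: "('i, 'a::vector_lattice) convergence" and emb :: "'a set \<times> 'a \<Rightarrow> 'i"
  assumes emb: "inj emb" and \<eta>: "locally_solid_additive \<eta>" and E: "order_ideal E"
  shows "l \<in> adherence \<eta> E \<longleftrightarrow>
    \<eta> (cone_rel emb E) (\<lambda>a. pprt (\<bar>l\<bar> - cone_elem emb a)) 0"
proof
  assume "l \<in> adherence \<eta> E"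
  then obtain r f where f: "f ` Field r \<subseteq> E" "\<eta> r f l"
    by (auto simp: adherence_def)
  then have "\<eta> r (\<lambda>a. \<bar>f a - l\<bar>) 0"
    using lsa_conv_iff_null[OF \<eta>] by blast
  then show "\<eta> (cone_rel emb E) (\<lambda>a. pprt (\<bar>l\<bar> - cone_elem emb a)) 0"
  proof (rule cone_tail_dominated[OF emb \<eta> E])
    fix a assume a: "a \<in> Field r"
    have "pprt (\<bar>l\<bar> - e') \<le> \<bar>f a - l\<bar>" if "\<bar>f a\<bar> \<le> e'" for e'
    proof -
      have "pprt (\<bar>l\<bar> - e') \<le> pprt (\<bar>l\<bar> - \<bar>f a\<bar>)"
        using that by (intro pprt_mono) simp
      also have "\<dots> \<le> \<bar>l - f a\<bar>"
        by (rule pprt_abs_diff_le)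
      finally show ?thesis
        by (simp add: abs_minus_commute)
    qed
    then show "\<exists>e\<in>E. 0 \<le> e \<and> (\<forall>e'\<in>E. e \<le> e' \<longrightarrow> \<bar>pprt (\<bar>l\<bar> - e')\<bar> \<le> \<bar>\<bar>f a - l\<bar>\<bar>)"
      using order_ideal_abs[OF E, of "f a"] f(1) a
      by (intro bexI[of _ "\<bar>f a\<bar>"]) (auto simp: abs_pprt)
  qed
next
  let ?r = "cone_rel emb E" and ?e = "cone_elem emb"
  assume null: "\<eta> ?r (\<lambda>a. pprt (\<bar>l\<bar> - ?e a)) 0"
  \<comment> \<open>The truncation error of \<open>x\<close> is \<open>pprt (x - ?e a)\<close>,
    which the given null net dominates since \<open>x \<le> \<bar>l\<bar>\<close>.\<close>
  have conv: "\<eta> ?r (\<lambda>a. inf x (?e a)) x" if x: "0 \<le> x" "x \<le> \<bar>l\<bar>" for x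
    unfolding lsa_conv_iff_null[OF \<eta>, of _ _ x]
  proof (rule lsa_dominated[OF \<eta>, OF null])
    fix a
    have "\<bar>inf x (?e a) - x\<bar> = \<bar>x - inf x (?e a)\<bar>"
      by (rule abs_minus_commute)
    also have "\<dots> = pprt (x - ?e a)"
      by (simp only: diff_inf_eq_pprt abs_pprt)
    also have "\<dots> \<le> pprt (\<bar>l\<bar> - ?e a)"
      by (rule pprt_diff_mono[OF x(2)])
    finally have "\<bar>inf x (?e a) - x\<bar> \<le> pprt (\<bar>l\<bar> - ?e a)" .
    then show "\<bar>\<bar>inf x (?e a) - x\<bar>\<bar> \<le> \<bar>pprt (\<bar>l\<bar> - ?e a)\<bar>"
      by (simp only: abs_pprt abs_idempotent)
  qed
  \<comment> \<open>Positive and negative part are truncated separately, as \<open>conv\<close>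
    needs nonnegative elements; their difference recovers \<open>l\<close>.\<close>
  let ?f = "\<lambda>a. inf (pprt l) (?e a) + - inf (pprt (- l)) (?e a)"
  have "\<eta> ?r (\<lambda>a. inf (pprt l) (?e a)) (pprt l)"
    by (rule conv) (auto simp: pprt_le_iff abs_ge_self)
  moreover have "\<eta> ?r (\<lambda>a. inf (pprt (- l)) (?e a)) (pprt (- l))"
    by (rule conv) (auto simp: pprt_le_iff abs_ge_minus_self)
  then have "\<eta> ?r (\<lambda>a. - inf (pprt (- l)) (?e a)) (- pprt (- l))"
    by (rule lsa_uminus[OF \<eta>])
  ultimately have "\<eta> ?r ?f (pprt l + - pprt (- l))"
    by (rule lsa_add[OF \<eta>])
  also have "pprt l + - pprt (- l) = l"
    using prts[of l] by (simp add: pprt_neg)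
  finally have "\<eta> ?r ?f l" .
  moreover have "?f a \<in> E" if "a \<in> Field ?r" for a
  proof -
    have "subspace E"
      using E by (simp add: order_ideal_def)
    moreover have "inf (pprt x) (?e a) \<in> E" for x
      using cone_elem_Field[OF emb that] by (intro order_ideal_inf[OF E]) auto
    ultimately show ?thesis
      by (intro subspace_add subspace_neg)
  qed
  ultimately show "l \<in> adherence \<eta> E"
    unfolding adherence_def by (intro CollectI exI[of _ ?r] exI[of _ ?f] conjI image_subsetI)
qed

text \<open>The usable half of \<open>conv_comp \<eta> \<eta> = \<eta>\<close>: for a null net
  \<open>g\<close>, it suffices to treat the excess of \<open>f\<close> over one fixed
  \<open>g b\<close> at a time.\<close>

lemma idempotent_null:
  assumes "idempotent_convergence \<eta>" "\<eta> s g 0" "\<And>b. b \<in> Field s \<Longrightarrow> 0 \<le> g b"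
    and "\<And>a. 0 \<le> f a" "\<And>b. b \<in> Field s \<Longrightarrow> \<eta> r (\<lambda>a. pprt (f a - g b)) 0"
  shows "\<eta> r f 0"
proof -
  have "conv_comp \<eta> \<eta> r f 0"
    unfolding conv_comp_def from_null_def using assms(2-)
    by (intro exI[of _ s] exI[of _ g]) (simp add: abs_of_nonneg)
  then show ?thesis
    using assms(1) by (simp add: idempotent_convergence_def)
qed

lemma adherence_mono: "A \<subseteq> B \<Longrightarrow> adherence \<eta> A \<subseteq> adherence \<eta> B"
  unfolding adherence_def by blast

text \<open>Every closed set containing \<open>E\<close> contains its adherence, so the point is
  that the adherence is itself closed. The cone criterion turns this iterated limit into an instance
  of idempotency.\<close>

lemma adherence_eq_closure:
  fixes \<eta> :: "('i, 'a::vector_lattice) convergence" and emb :: "'a set \<times> 'a \<Rightarrow> 'i"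
  assumes emb: "inj emb" and \<eta>: "locally_solid_additive \<eta>" and E: "order_ideal E"
    and idem: "idempotent_convergence \<eta>"
  shows "adherence \<eta> E = conv_closure \<eta> E"
proof
  show "adherence \<eta> E \<subseteq> conv_closure \<eta> E"
    unfolding conv_closure_def
  proof (rule Inter_greatest)
    fix B assume "B \<in> {B. E \<subseteq> B \<and> conv_closed \<eta> B}"
    then show "adherence \<eta> E \<subseteq> B"
      using adherence_mono[of E B \<eta>] by (simp add: conv_closed_def)
  qed
  have "l \<in> adherence \<eta> E" if l: "l \<in> adherence \<eta> (adherence \<eta> E)" for l
  proof -
    obtain s y where y: "y ` Field s \<subseteq> adherence \<eta> E" "\<eta> s y l"
      using l unfolding adherence_def[of _ "adherence \<eta> E"] by blast
    \<comment> \<open>Idempotency is applied with \<open>g b = \<bar>y b - l\<bar>\<close>. For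
      fixed \<open>b\<close> the excess is dominated by \<open>pprt (\<bar>y b\<bar> - e)\<close>,
      which is null because \<open>y b\<close> is adherent to \<open>E\<close>.\<close>
    have "\<eta> (cone_rel emb E) (\<lambda>a. pprt (\<bar>l\<bar> - cone_elem emb a)) 0"
    proof (rule idempotent_null[OF idem])
      show "\<eta> s (\<lambda>b. \<bar>y b - l\<bar>) 0"
        using y(2) lsa_conv_iff_null[OF \<eta>] by blast
    next
      fix b assume "b \<in> Field s"
      then have "\<eta> (cone_rel emb E) (\<lambda>a. pprt (\<bar>y b\<bar> - cone_elem emb a)) 0"
        using y(1) adherence_ideal_iff[OF emb \<eta> E] by blast
      then show "\<eta> (cone_rel emb E) (\<lambda>a. pprt (pprt (\<bar>l\<bar> - cone_elem emb a) - \<bar>y b - l\<bar>)) 0"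
      proof (rule lsa_dominated[OF \<eta>])
        fix a
        let ?e = "cone_elem emb a"
        have "\<bar>l\<bar> - ?e \<le> \<bar>y b - l\<bar> + (\<bar>y b\<bar> - ?e)"
          using abs_triangle_ineq[of "l - y b" "y b"] by (simp add: abs_minus_commute)
        also have "\<dots> \<le> \<bar>y b - l\<bar> + pprt (\<bar>y b\<bar> - ?e)"
          by (simp add: pprt_def)
        finally have "pprt (\<bar>l\<bar> - ?e) \<le> pprt (\<bar>y b\<bar> - ?e) + \<bar>y b - l\<bar>"
          by (simp add: pprt_le_iff add.commute)
        then show "\<bar>pprt (pprt (\<bar>l\<bar> - ?e) - \<bar>y b - l\<bar>)\<bar> \<le> \<bar>pprt (\<bar>y b\<bar> - ?e)\<bar>"
          by (simp add: abs_pprt pprt_le_iff diff_le_eq)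
      qed
    qed auto
    then show ?thesis
      using adherence_ideal_iff[OF emb \<eta> E] by blast
  qed
  then have "conv_closed \<eta> (adherence \<eta> E)"
    unfolding conv_closed_def using subset_adherence[OF lsa_is_convergence[OF \<eta>]] by (intro equalityI subsetI) auto
  then show "conv_closure \<eta> E \<subseteq> adherence \<eta> E"
    unfolding conv_closure_def
    by (intro Inter_lower CollectI conjI subset_adherence lsa_is_convergence \<eta>)
qed

section \<open>Comparison of unbounded modifications\<close>

text \<open>Beyond the threshold \<open>(n + 1) \<bar>e\<bar>\<close> in the cone,
  \<open>scaleR_inf_pprt_le\<close> bounds the infimum with \<open>\<bar>e\<bar>\<close> by
  \<open>\<bar>h\<bar> / (n + 1)\<close>, and linearity makes these bounds null.\<close>

lemma cone_net_unbounded_null: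
  fixes \<theta> :: "('i, 'a::vector_lattice) convergence" and emb :: "'a set \<times> 'a \<Rightarrow> 'i"
  assumes emb: "inj emb" and \<theta>: "locally_solid_additive \<theta>" "linear_convergence \<theta>"
    and E: "order_ideal E"
  shows "unbounded_mod E \<theta> (cone_rel emb E) (\<lambda>a. pprt (\<bar>h\<bar> - cone_elem emb a)) 0"
proof (cases "h = 0")
  case True
  have "\<theta> (cone_rel emb E) (\<lambda>a. inf \<bar>e\<bar> \<bar>pprt (\<bar>h\<bar> - cone_elem emb a) - 0\<bar>) 0" for e
  proof (rule lsa_dominated[OF \<theta>(1), OF lsa_const[OF \<theta>(1) directed_cone_rel[OF emb E]]])
    fix a assume "a \<in> Field (cone_rel emb E)"
    then show "\<bar>inf \<bar>e\<bar> \<bar>pprt (\<bar>h\<bar> - cone_elem emb a) - 0\<bar>\<bar> \<le> \<bar>0\<bar>"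
      using cone_elem_Field[OF emb] True by (simp add: inf_absorb2)
  qed
  then show ?thesis
    by (simp add: unbounded_mod_def from_null_def)
next
  case False
  \<comment> \<open>The multiples of \<open>h\<close> provide the copy of the natural numbers; they
    are distinct only for \<open>h \<noteq> 0\<close>, hence the case split.\<close>
  define k where "k n = emb ({}, real n *\<^sub>R h)" for n
  have k: "inj k"
  proof (rule injI)
    fix m n assume "k m = k n"
    then have "real m *\<^sub>R h = real n *\<^sub>R h"
      using emb by (simp add: k_def inj_eq)
    then show "m = n"
      using False by simp
  qed
  have "\<theta> (cone_rel emb E) (\<lambda>a. inf \<bar>e\<bar> (pprt (\<bar>h\<bar> - cone_elem emb a))) 0" if e: "e \<in> E" for e
  proof (rule cone_tail_dominated[OF emb \<theta>(1) E, OF linear_inverse_Suc_null[OF k \<theta>(2), of "\<bar>h\<bar>"]])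
    fix a assume "a \<in> Field (rel_image k UNIV (\<le>))"
    let ?n = "inv k a"
    have "real (Suc ?n) *\<^sub>R \<bar>e\<bar> \<in> E"
      using order_ideal_abs[OF E e] E unfolding order_ideal_def by (blast intro: subspace_scale)
    moreover have "\<bar>inf \<bar>e\<bar> (pprt (\<bar>h\<bar> - e'))\<bar> \<le> \<bar>inverse (real (Suc ?n)) *\<^sub>R (\<bar>h\<bar>)\<bar>"
      if "real (Suc ?n) *\<^sub>R \<bar>e\<bar> \<le> e'" for e'
    proof -
      have "\<bar>inf \<bar>e\<bar> (pprt (\<bar>h\<bar> - e'))\<bar> = inf \<bar>e\<bar> (pprt (\<bar>h\<bar> - e'))"
        by (rule abs_inf_nonneg) auto
      also have "\<dots> \<le> inverse (real (Suc ?n)) *\<^sub>R \<bar>h\<bar>"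
        by (rule scaleR_inf_pprt_le[OF _ _ that]) auto
      finally show ?thesis
        using abs_ge_self order_trans by blast
    qed
    moreover have "0 \<le> real (Suc ?n) *\<^sub>R \<bar>e\<bar>"
      by (intro scaleR_nonneg_nonneg) auto
    ultimately show "\<exists>e''\<in>E. 0 \<le> e'' \<and> (\<forall>e'\<in>E. e'' \<le> e' \<longrightarrow>
        \<bar>inf \<bar>e\<bar> (pprt (\<bar>h\<bar> - e'))\<bar> \<le> \<bar>inverse (real (Suc ?n)) *\<^sub>R (\<bar>h\<bar>)\<bar>)"
      by (intro bexI[of _ "real (Suc ?n) *\<^sub>R \<bar>e\<bar>"] conjI ballI impI)
  qed
  then show ?thesis
    by (simp add: unbounded_mod_def from_null_def abs_pprt)
qed

text \<open>For points of \<open>{0..e}\<close> the distance \<open>\<bar>f a - l\<bar>\<close> is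
  at most \<open>e\<close>, so testing \<open>unbounded_mod H \<eta>\<close> at \<open>e\<close>
  truncates nothing and returns plain \<open>\<eta>\<close>-convergence.\<close>

lemma stronger_on_interval:
  assumes \<eta>: "locally_solid_additive \<eta>" and \<theta>: "locally_solid_additive \<theta>"
    and st: "stronger (unbounded_mod E \<theta>) (unbounded_mod H \<eta>)" and e: "e \<in> H" "0 \<le> e"
  shows "stronger_on {0..e} \<theta> \<eta>"
  unfolding stronger_on_def
proof (intro allI impI)
  fix r f l assume f: "f ` Field r \<subseteq> {0..e}" and l: "l \<in> {0..e}" and conv: "\<theta> r f l"
  have "\<theta> r (\<lambda>a. \<bar>f a - l\<bar>) 0"
    using conv lsa_conv_iff_null[OF \<theta>] by blast
  then have "\<theta> r (\<lambda>a. inf \<bar>e'\<bar> \<bar>f a - l\<bar>) 0" for e'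
    by (rule lsa_dominated[OF \<theta>]) (simp add: abs_inf_nonneg)
  then have "unbounded_mod E \<theta> r f l"
    by (simp add: unbounded_mod_def from_null_def)
  then have "unbounded_mod H \<eta> r f l"
    using st by (simp add: stronger_on_def)
  then have "\<eta> r (\<lambda>a. inf \<bar>e\<bar> \<bar>f a - l\<bar>) 0"
    using e(1) by (simp add: unbounded_mod_def from_null_def)
  then have "\<eta> r (\<lambda>a. \<bar>f a - l\<bar>) 0"
  proof (rule lsa_dominated[OF \<eta>])
    fix a assume "a \<in> Field r"
    then have "0 \<le> f a" "f a \<le> e" "0 \<le> l" "l \<le> e"
      using f l by auto
    then have "f a - l \<le> e" "- (f a - l) \<le> e"
      by (simp_all add: diff_le_eq add_increasing2)
    then have "\<bar>f a - l\<bar> \<le> \<bar>e\<bar>"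
      using e by (simp add: abs_leI abs_of_nonneg)
    then show "\<bar>\<bar>f a - l\<bar>\<bar> \<le> \<bar>inf \<bar>e\<bar> \<bar>f a - l\<bar>\<bar>"
      by (simp add: inf_absorb2)
  qed
  then show "\<eta> r f l"
    using lsa_conv_iff_null[OF \<eta>] by blast
qed

text \<open>To test at \<open>h\<close>, approximate it by \<open>x b\<close> in \<open>E\<close>.
  Idempotency allows \<open>b\<close> to be fixed at the cost of an error
  \<open>\<bar>x b - h\<bar>\<close>, and then \<open>h\<close> can be replaced by an element of
  both ideals.\<close>

lemma stronger_unbounded_mod:
  assumes \<eta>: "locally_solid_additive \<eta>" and E: "order_ideal E" and H: "order_ideal H"
    and idem: "idempotent_convergence \<eta>" and HE: "H \<subseteq> adherence \<eta> E"
    and st: "\<And>e. e \<in> E \<inter> H \<Longrightarrow> 0 \<le> e \<Longrightarrow> stronger_on {0..e} \<theta> \<eta>"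
  shows "stronger (unbounded_mod E \<theta>) (unbounded_mod H \<eta>)"
  unfolding stronger_on_def
proof (intro allI impI)
  fix r f l assume f: "unbounded_mod E \<theta> r f l"
  have "\<eta> r (\<lambda>a. inf \<bar>h\<bar> \<bar>f a - l\<bar>) 0" if h: "h \<in> H" for h
  proof -
    obtain s x where x: "x ` Field s \<subseteq> E" "\<eta> s x h"
      using h HE by (auto simp: adherence_def)
    show ?thesis
    proof (rule idempotent_null[OF idem])
      show "\<eta> s (\<lambda>b. \<bar>x b - h\<bar>) 0"
        using x(2) lsa_conv_iff_null[OF \<eta>] by blast
    next
      fix b assume "b \<in> Field s"
      then have xb: "x b \<in> E"
        using x(1) by blast
      \<comment> \<open>Being below both \<open>\<bar>h\<bar>\<close> and
        \<open>\<bar>x b\<bar>\<close>, this \<open>e\<close> lies in \<open>E \<inter> H\<close>.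
        The net \<open>inf e \<bar>f a - l\<bar>\<close> stays in \<open>{0..e}\<close>, where
        \<open>\<theta>\<close>-nullity passes to \<open>\<eta>\<close>.\<close>
      define e where "e = inf \<bar>h\<bar> \<bar>x b\<bar>"
      have e: "e \<in> E" "e \<in> H" "0 \<le> e"
        using order_ideal_inf[OF E order_ideal_abs[OF E xb], of "\<bar>h\<bar>"]
          order_ideal_inf[OF H order_ideal_abs[OF H h], of "\<bar>x b\<bar>"]
        by (auto simp: e_def inf_commute)
      have "\<theta> r (\<lambda>a. inf \<bar>e\<bar> \<bar>f a - l\<bar>) 0"
        using f e(1) by (simp add: unbounded_mod_def from_null_def)
      then have "\<theta> r (\<lambda>a. inf e \<bar>f a - l\<bar>) 0"
        by (simp only: abs_of_nonneg[OF e(3)])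
      moreover have "stronger_on {0..e} \<theta> \<eta>"
        using st e by blast
      moreover have "(\<lambda>a. inf e \<bar>f a - l\<bar>) ` Field r \<subseteq> {0..e}" "0 \<in> {0..e}"
        using e(3) by auto
      ultimately have "\<eta> r (\<lambda>a. inf e \<bar>f a - l\<bar>) 0"
        unfolding stronger_on_def by blast
      then show "\<eta> r (\<lambda>a. pprt (inf \<bar>h\<bar> \<bar>f a - l\<bar> - \<bar>x b - h\<bar>)) 0"
      proof (rule lsa_dominated[OF \<eta>])
        fix a
        \<comment> \<open>Replacing \<open>\<bar>h\<bar>\<close> by \<open>e\<close> loses at most
          \<open>\<bar>x b - h\<bar>\<close>, precisely the amount subtracted in the positive
          part.\<close>
        have "\<bar>h\<bar> - e = pprt (\<bar>h\<bar> - \<bar>x b\<bar>)"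
          by (simp only: e_def diff_inf_eq_pprt)
        also have "\<dots> \<le> \<bar>x b - h\<bar>"
          using pprt_abs_diff_le[of h "x b"] by (simp add: abs_minus_commute)
        finally have "\<bar>h\<bar> - \<bar>x b - h\<bar> \<le> e"
          by (simp add: algebra_simps)
        then have "inf \<bar>h\<bar> \<bar>f a - l\<bar> - \<bar>x b - h\<bar> \<le> e"
          by (meson diff_right_mono inf_le1 order_trans)
        moreover have "inf \<bar>h\<bar> \<bar>f a - l\<bar> - \<bar>x b - h\<bar> \<le> \<bar>f a - l\<bar>"
          by (simp add: diff_le_eq add_increasing2 le_infI2)
        ultimately show "\<bar>pprt (inf \<bar>h\<bar> \<bar>f a - l\<bar> - \<bar>x b - h\<bar>)\<bar> \<le> \<bar>inf e \<bar>f a - l\<bar>\<bar>"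
          using e(3) by (simp add: abs_pprt pprt_le_iff abs_inf_nonneg)
      qed
    qed auto
  qed
  then show "unbounded_mod H \<eta> r f l"
    by (simp add: unbounded_mod_def from_null_def)
qed

text \<open>The cone net for \<open>h\<close> is null for \<open>unbounded_mod E \<theta>\<close>,
  hence for \<open>unbounded_mod H \<eta>\<close>. It is bounded by \<open>\<bar>h\<bar>\<close>, so
  testing at \<open>h\<close> itself gives \<open>\<eta>\<close>-nullity, which is the criterion for
  adherence.\<close>

lemma subset_adherence_ideal:
  fixes \<eta> \<theta> :: "('i, 'a::vector_lattice) convergence" and emb :: "'a set \<times> 'a \<Rightarrow> 'i"
  assumes emb: "inj emb" and \<eta>: "locally_solid_additive \<eta>"
    and \<theta>: "locally_solid_additive \<theta>" "linear_convergence \<theta>" and E: "order_ideal E"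
    and st: "stronger (unbounded_mod E \<theta>) (unbounded_mod H \<eta>)"
  shows "H \<subseteq> adherence \<eta> E"
proof
  fix h assume h: "h \<in> H"
  have "unbounded_mod H \<eta> (cone_rel emb E) (\<lambda>a. pprt (\<bar>h\<bar> - cone_elem emb a)) 0"
    using cone_net_unbounded_null[OF emb \<theta> E] st by (simp add: stronger_on_def)
  then have "\<eta> (cone_rel emb E) (\<lambda>a. inf \<bar>h\<bar> (pprt (\<bar>h\<bar> - cone_elem emb a))) 0"
    using h by (simp add: unbounded_mod_def from_null_def abs_pprt)
  then have "\<eta> (cone_rel emb E) (\<lambda>a. pprt (\<bar>h\<bar> - cone_elem emb a)) 0"
  proof (rule lsa_dominated[OF \<eta>])
    fix a assume "a \<in> Field (cone_rel emb E)"
    then have "pprt (\<bar>h\<bar> - cone_elem emb a) \<le> \<bar>h\<bar>"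
      using cone_elem_Field[OF emb] by (auto simp: pprt_le_iff diff_le_eq)
    then show "\<bar>pprt (\<bar>h\<bar> - cone_elem emb a)\<bar> \<le> \<bar>inf \<bar>h\<bar> (pprt (\<bar>h\<bar> - cone_elem emb a))\<bar>"
      by (simp add: inf_absorb2)
  qed
  then show "h \<in> adherence \<eta> E"
    using adherence_ideal_iff[OF emb \<eta> E] by blast
qed

theorem theorem3p15:
  fixes \<eta> \<theta> :: "('i, 'a::archimedean_vector_lattice) convergence"
    and E H :: "'a set"
    and emb :: "'a set \<times> 'a \<Rightarrow> 'i"
  assumes "inj emb"
    and "locally_solid_additive \<eta>" and "locally_solid_additive \<theta>"
    and "order_ideal E" and "order_ideal H"
  shows "(linear_convergence \<theta> \<and> stronger (unbounded_mod E \<theta>) (unbounded_mod H \<eta>) \<longrightarrow>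
            H \<subseteq> adherence \<eta> E \<and> (\<forall>e \<in> E \<inter> H. 0 \<le> e \<longrightarrow> stronger_on {0..e} \<theta> \<eta>))
       \<and> (idempotent_convergence \<eta> \<longrightarrow>
            adherence \<eta> E = conv_closure \<eta> E \<and>
            (H \<subseteq> adherence \<eta> E \<and> (\<forall>e \<in> E \<inter> H. 0 \<le> e \<longrightarrow> stronger_on {0..e} \<theta> \<eta>) \<longrightarrow>
               stronger (unbounded_mod E \<theta>) (unbounded_mod H \<eta>)))"
proof (intro conjI impI)
  assume i: "linear_convergence \<theta> \<and> stronger (unbounded_mod E \<theta>) (unbounded_mod H \<eta>)"
  show "H \<subseteq> adherence \<eta> E"
    using subset_adherence_ideal[OF assms(1-3) _ assms(4)] i by blast
  show "\<forall>e\<in>E \<inter> H. 0 \<le> e \<longrightarrow> stronger_on {0..e} \<theta> \<eta>"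
    using stronger_on_interval[OF assms(2,3)] i by blast
next
  assume idem: "idempotent_convergence \<eta>"
  show "adherence \<eta> E = conv_closure \<eta> E"
    using adherence_eq_closure[OF assms(1,2,4) idem] .
  assume "H \<subseteq> adherence \<eta> E \<and> (\<forall>e\<in>E \<inter> H. 0 \<le> e \<longrightarrow> stronger_on {0..e} \<theta> \<eta>)"
  then show "stronger (unbounded_mod E \<theta>) (unbounded_mod H \<eta>)"
    using stronger_unbounded_mod[OF assms(2,4,5) idem] by blast
qed

end
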